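(* Let $0<\alpha\le2$, let $X$ be a symmetric $\alpha$-stable Lévy process, and let $p_t$ be the density of $X_t$. For every $\varepsilon>0$ and every integer $n\ge0$ there exists a finite constant $c_{n,\varepsilon}$ such that $$\sup_{|x|>\varepsilon}\big|p_t^{(n)}(x)\big|\le c_{n,\varepsilon}\,t\qquad\text{for all }0<t\le1.$$
   Context: A symmetric $\alpha$-stable Lévy process ($0<\alpha\le2$) is normalized so that $\mathbb{E}e^{\mathrm{i}uX_t}=e^{-t|u|^\alpha}$ for $u\in\mathbb{R}$, $t\ge0$. For $t>0$, $X_t$ has a $C^\infty$ density $p_t$; $p_t^{(n)}$ is its $n$-th derivative in $x$. *)

theory Defs
  imports "HOL-Probability.Probability"
begin

text \<open>
  Real-valued Levy processes, with time set the nonnegative reals; the values \<open>X t\<close> for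
  negative \<open>t\<close> play no role. Path regularity enters through stochastic continuity only, so
  processes with right-continuous paths with left limits are covered: together with the
  stationary increments, such paths imply stochastic continuity.
\<close>

definition independent_increments :: "'a measure \<Rightarrow> (real \<Rightarrow> 'a \<Rightarrow> real) \<Rightarrow> bool" where
  "independent_increments M X \<longleftrightarrow>
     (\<forall>(n::nat) (\<tau> :: nat \<Rightarrow> real). 0 \<le> \<tau> 0 \<longrightarrow> (\<forall>i<n. \<tau> i < \<tau> (Suc i)) \<longrightarrow>
        prob_space.indep_vars M (\<lambda>_. borel) (\<lambda>i \<omega>. X (\<tau> (Suc i)) \<omega> - X (\<tau> i) \<omega>) {..<n})"

definition stationary_increments :: "'a measure \<Rightarrow> (real \<Rightarrow> 'a \<Rightarrow> real) \<Rightarrow> bool" where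
  "stationary_increments M X \<longleftrightarrow>
     (\<forall>s\<ge>0. \<forall>h\<ge>0. distr M borel (\<lambda>\<omega>. X (s + h) \<omega> - X s \<omega>) =
                    distr M borel (\<lambda>\<omega>. X h \<omega> - X 0 \<omega>))"

definition stochastically_continuous :: "'a measure \<Rightarrow> (real \<Rightarrow> 'a \<Rightarrow> real) \<Rightarrow> bool" where
  "stochastically_continuous M X \<longleftrightarrow>
     (\<forall>s\<ge>0. \<forall>\<epsilon>>0.
        ((\<lambda>t. measure M {\<omega> \<in> space M. \<epsilon> < \<bar>X t \<omega> - X s \<omega>\<bar>}) \<longlongrightarrow> 0) (at s within {0..}))"

definition levy_process :: "'a measure \<Rightarrow> (real \<Rightarrow> 'a \<Rightarrow> real) \<Rightarrow> bool" where
  "levy_process M X \<longleftrightarrow>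
     prob_space M \<and>
     (\<forall>t\<ge>0. X t \<in> borel_measurable M) \<and>
     (AE \<omega> in M. X 0 \<omega> = 0) \<and>
     independent_increments M X \<and>
     stationary_increments M X \<and>
     stochastically_continuous M X"

text \<open>
  The normalization is \<open>E exp (i u X\<^sub>t) = exp (-t |u|\<^sup>\<alpha>)\<close>, so \<open>\<alpha> = 2\<close> is
  Brownian motion with variance \<open>2 t\<close>. At \<open>u = 0\<close> the convention \<open>0 powr \<alpha> = 0\<close>
  gives the value \<open>1\<close>.
\<close>

definition symmetric_stable_levy_process ::
    "real \<Rightarrow> 'a measure \<Rightarrow> (real \<Rightarrow> 'a \<Rightarrow> real) \<Rightarrow> bool" where
  "symmetric_stable_levy_process \<alpha> M X \<longleftrightarrow>
     levy_process M X \<and>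
     (\<forall>t\<ge>0. \<forall>u. char (distr M borel (X t)) u = complex_of_real (exp (- t * \<bar>u\<bar> powr \<alpha>)))"

definition smooth :: "(real \<Rightarrow> real) \<Rightarrow> bool" where
  "smooth f \<longleftrightarrow> (\<forall>n x. (deriv ^^ n) f differentiable (at x))"

text \<open>
  A density is determined only almost everywhere; smoothness selects the version whose
  derivatives are meant. Nonnegativity is required separately because \<open>ennreal\<close> maps
  negative numbers to \<open>0\<close>.
\<close>

definition smooth_density :: "'a measure \<Rightarrow> ('a \<Rightarrow> real) \<Rightarrow> (real \<Rightarrow> real) \<Rightarrow> bool" where
  "smooth_density M Y f \<longleftrightarrow>
     (\<forall>x. 0 \<le> f x) \<and> distributed M lborel Y (\<lambda>x. ennreal (f x)) \<and> smooth f"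

end

theory Submission
  imports Defs "HOL-Complex_Analysis.Complex_Analysis"
begin

text \<open>
  For \<open>0 < a < b\<close>, Levy's inversion formula gives \<open>\<pi> P(a < X\<^sub>t \<le> b)\<close> as the limit of the integral
  over \<open>{0..T}\<close> of \<open>Re ((exp (-iua) - exp (-iub)) / (iu))\<close> times \<open>exp (-t u\<^sup>\<alpha>)\<close>. Replacing the last
  factor by \<open>exp (-t u\<^sup>\<alpha>) - 1\<close> changes nothing in the limit, because both sine integrals
  converge to \<open>\<pi>/2\<close>. Now rotate the contour to the ray \<open>u = (1 - i) s\<close>: since \<open>\<alpha> \<le> 2\<close>, the real
  part of \<open>u\<^sup>\<alpha>\<close> stays nonnegative on the sector swept out, hence \<open>|exp (-t u\<^sup>\<alpha>) - 1| \<le> t |u|\<^sup>\<alpha>\<close>. On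
  the ray the integrand decays exponentially, so the density and all its derivatives on the
  half-line are absolutely convergent Laplace-type integrals, each carrying the factor \<open>t\<close>.
\<close>

section \<open>Elementary estimates\<close>

text \<open>The integrand is the modulus of the complex Gamma integrand with parameter
  \<open>a + 1 > 0\<close>, whose absolute integrability is known.\<close>

lemma integrable_powr_exp:
  fixes a x :: real
  assumes "a > -1" "x > 0"
  shows "integrable lborel (\<lambda>s. indicator {0<..} s * (s powr a * exp (- x * s)))"
proof -
  have "(\<lambda>t. complex_of_real t powr (of_real (a + 1) - 1) / of_real (exp (x * t)))
      absolutely_integrable_on {0<..}"
    using assms by (intro absolutely_integrable_Gamma_integral) auto
  then have "(\<lambda>t. norm (complex_of_real t powr (of_real (a + 1) - 1) / of_real (exp (x * t))))
      absolutely_integrable_on {0<..}"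
    by (rule set_integrable_norm)
  then have "(\<lambda>t. t powr a * exp (- x * t)) absolutely_integrable_on {0<..}"
    by (rule set_integrable_cong[THEN iffD1, rotated -1])
       (auto simp: norm_divide norm_powr_real_powr exp_minus field_simps)
  then show ?thesis
    by (simp add: set_integrable_def integrable_completion)
qed

lemma norm_exp_minus_one_minus_le: "norm (exp w - 1 - w) \<le> exp (norm w) * (norm w)\<^sup>2" for w :: complex
  using Taylor_exp_field[of w 1] by (simp add: power2_eq_square algebra_simps)

text \<open>Mean value inequality on the convex right half-plane, where the derivative of
  \<open>exp (-z)\<close> has modulus at most 1. Unlike a Taylor bound it holds for arbitrarily
  large \<open>w\<close>; it later produces the factor \<open>t\<close>.\<close>

lemma norm_exp_minus_one_le:
  fixes w :: complex
  assumes "Re w \<ge> 0"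
  shows "norm (exp (-w) - 1) \<le> norm w"
proof -
  have "norm (exp (-w) - exp (-0)) \<le> 1 * norm (w - 0)"
  proof (rule field_differentiable_bound[where S = "{z. Re z \<ge> 0}" and f = "\<lambda>z. exp (-z)"])
    show "convex {z. 0 \<le> Re z}" by (rule convex_halfspace_Re_ge)
  qed (use assms in \<open>auto intro!: derivative_eq_intros\<close>)
  then show ?thesis by simp
qed

section \<open>Laplace-type integrals along a complex ray\<close>

text \<open>\<open>Re c = -1\<close> makes the exponential decay like \<open>exp (- s * x)\<close>,
  and \<open>\<beta> > -1\<close> gives integrability near 0. The indicator in the bound forces
  \<open>g\<close> to vanish for \<open>s \<le> 0\<close>, so integrals over the whole line are
  half-line integrals. The dependence on \<open>t\<close> will sit in \<open>B\<close> and
  \<open>g\<close> alone.\<close>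

locale laplace_weight =
  fixes c :: complex and g :: "real \<Rightarrow> complex" and B \<beta> :: real
  assumes Re_c: "Re c = -1"
    and meas [measurable]: "g \<in> borel_measurable borel"
    and g_bound: "\<And>s. norm (g s) \<le> B * (indicator {0<..} s * s powr \<beta>)"
    and beta: "\<beta> > -1"
begin

definition H :: "nat \<Rightarrow> real \<Rightarrow> complex" where
  "H k x = (\<integral>s. (c * s) ^ k * exp (c * s * x) * g s \<partial>lborel)"

lemma integrable_majorant:
  fixes x :: real and k :: nat
  assumes "x > 0"
  shows "integrable lborel (\<lambda>s. indicator {0<..} s * (s powr (k + \<beta>) * exp (- x * s)))"
  using integrable_powr_exp[of "k + \<beta>" x] assms beta by simp

lemma norm_integrand_le:
  fixes s x y :: real and k :: nat
  assumes "y \<le> x"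
  shows "norm ((c * s) ^ k * exp (c * s * x) * g s) \<le>
    norm c ^ k * B * (indicator {0<..} s * (s powr (k + \<beta>) * exp (- y * s)))"
proof (cases "s > 0")
  case True
  have "norm ((c * s) ^ k * exp (c * s * x) * g s) = norm c ^ k * s ^ k * exp (- s * x) * norm (g s)"
    using True by (simp add: norm_mult norm_power power_mult_distrib Re_c)
  also have "\<dots> \<le> norm c ^ k * s ^ k * exp (- y * s) * (B * s powr \<beta>)"
    using True assms g_bound[of s] by (intro mult_mono) (auto simp: mult.commute mult_right_mono)
  also have "\<dots> = norm c ^ k * B * (indicator {0<..} s * (s powr (k + \<beta>) * exp (- y * s)))"
    using True by (simp add: powr_add powr_realpow)
  finally show ?thesis .
next
  case False
  then have "g s = 0" using g_bound[of s] by simp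
  then show ?thesis using False by simp
qed

lemma integrable_integrand:
  fixes x :: real and k :: nat
  assumes "x > 0"
  shows "integrable lborel (\<lambda>s. (c * s) ^ k * exp (c * s * x) * g s)"
proof (rule Bochner_Integration.integrable_bound)
  show "integrable lborel (\<lambda>s. norm c ^ k * B * (indicator {0<..} s * (s powr (k + \<beta>) * exp (- x * s))))"
    using integrable_majorant[OF assms] by (rule integrable_mult_right)
  show "AE s in lborel. norm ((c * s) ^ k * exp (c * s * x) * g s) \<le>
      norm (norm c ^ k * B * (indicator {0<..} s * (s powr (k + \<beta>) * exp (- x * s))))"
    unfolding real_norm_def by (intro AE_I2 order.trans[OF norm_integrand_le[OF order.refl] abs_ge_self])
qed measurable

text \<open>The bound is uniform over \<open>x \<ge> y\<close> and linear in \<open>B\<close>: with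
  \<open>y\<close> set to \<epsilon> and \<open>B\<close> proportional to \<open>t\<close> this
  becomes the final estimate.\<close>

lemma norm_H_le:
  assumes "0 < y" "y \<le> x"
  shows "norm (H k x) \<le>
    norm c ^ k * B * (\<integral>s. indicator {0<..} s * (s powr (k + \<beta>) * exp (- y * s)) \<partial>lborel)"
proof -
  have "norm (H k x) \<le> (\<integral>s. norm ((c * s) ^ k * exp (c * s * x) * g s) \<partial>lborel)"
    unfolding H_def by (rule integral_norm_bound)
  also have "\<dots> \<le> (\<integral>s. norm c ^ k * B *
      (indicator {0<..} s * (s powr (k + \<beta>) * exp (- y * s))) \<partial>lborel)"
    using assms integrable_integrand[of x k] integrable_majorant[of y k] norm_integrand_le[of y x]
    by (intro integral_mono) auto
  finally show ?thesis by simp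
qed

text \<open>Differentiation under the integral sign with an explicit quadratic remainder. The
  second-order remainder of the exponential costs two powers of \<open>s\<close> and a growth
  factor, and half of the decay \<open>exp (- s * x)\<close> pays for both.\<close>

lemma has_vector_derivative_H:
  assumes "x > 0"
  shows "(H k has_vector_derivative H (Suc k) x) (at x)"
proof -
  have c1: "norm c \<ge> 1" using abs_Re_le_cmod[of c] Re_c by simp
  define K where "K = norm c ^ (k + 2) * B *
    (\<integral>s. indicator {0<..} s * (s powr ((k + 2) + \<beta>) * exp (- (x / 2) * s)) \<partial>lborel)"
  \<comment> \<open>Chosen so that \<open>\<bar>h\<bar> < d\<close> gives
    \<open>norm c * \<bar>h\<bar> \<le> x / 2\<close>: the growth
    \<open>exp (norm (c * s * h))\<close> then uses up at most half of the decay. Since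
    \<open>norm c \<ge> 1\<close>, also \<open>d \<le> x / 2\<close>, which keeps \<open>y\<close>
    positive.\<close>
  define d where "d = x / (2 * norm c)"
  have d: "d > 0" using assms c1 unfolding d_def by (intro divide_pos_pos) auto
  have "x / (2 * norm c) \<le> x / (2 * 1)" using assms c1 by (intro divide_left_mono mult_left_mono) auto
  then have d2: "d \<le> x / 2" by (simp add: d_def)
  have bound: "norm (H k y - H k x - (y - x) *\<^sub>R H (Suc k) x) \<le> K * (y - x)\<^sup>2"
    if y: "\<bar>y - x\<bar> < d" for y
  proof -
    have y0: "y > 0" using y d2 assms by linarith
    let ?h = "y - x"
    have eq: "(c * s) ^ k * exp (c * s * y) * g s - (c * s) ^ k * exp (c * s * x) * g s
        - ?h *\<^sub>R ((c * s) ^ Suc k * exp (c * s * x) * g s) =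
        (c * s) ^ k * exp (c * s * x) * g s * (exp (c * s * ?h) - 1 - c * s * ?h)" for s :: real
    proof -
      have "exp (c * s * y) = exp (c * s * x) * exp (c * s * ?h)"
        by (simp add: exp_add[symmetric] algebra_simps)
      then show ?thesis by (simp add: algebra_simps scaleR_conv_of_real)
    qed
    let ?u = "\<lambda>s. (c * of_real s) ^ k * exp (c * of_real s * of_real y) * g s"
    let ?v = "\<lambda>s. (c * of_real s) ^ k * exp (c * of_real s * of_real x) * g s"
    let ?w = "\<lambda>s. (c * of_real s) ^ Suc k * exp (c * of_real s * of_real x) * g s"
    have int: "integrable lborel ?u" "integrable lborel ?v" "integrable lborel ?w"
      by (rule integrable_integrand[OF y0] integrable_integrand[OF assms])+
    have int': "integrable lborel (\<lambda>s. ?u s - ?v s - ?h *\<^sub>R ?w s)"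
      by (rule Bochner_Integration.integrable_diff[OF Bochner_Integration.integrable_diff[OF int(1,2)]
            integrable_scaleR_right[OF int(3)]])
    have "integral\<^sup>L lborel (\<lambda>s. ?u s - ?v s - ?h *\<^sub>R ?w s) =
        integral\<^sup>L lborel ?u - integral\<^sup>L lborel ?v - ?h *\<^sub>R integral\<^sup>L lborel ?w"
      by (subst Bochner_Integration.integral_diff[OF Bochner_Integration.integrable_diff[OF int(1,2)]
            integrable_scaleR_right[OF int(3)]],
          subst Bochner_Integration.integral_diff[OF int(1,2)],
          subst integral_scaleR_right, rule refl)
    then have int_eq: "H k y - H k x - ?h *\<^sub>R H (Suc k) x =
        (\<integral>s. (c * s) ^ k * exp (c * s * x) * g s * (exp (c * s * ?h) - 1 - c * s * ?h) \<partial>lborel)"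
      unfolding H_def eq by (rule sym)
    have "norm (H k y - H k x - ?h *\<^sub>R H (Suc k) x) \<le> (\<integral>s. norm ((c * s) ^ k * exp (c * s * x) * g s *
        (exp (c * s * ?h) - 1 - c * s * ?h)) \<partial>lborel)"
      unfolding int_eq by (rule integral_norm_bound)
    also have "\<dots> \<le> (\<integral>s. ?h\<^sup>2 * (norm c ^ (k+2) * B *
        (indicator {0<..} s * (s powr ((k+2) + \<beta>) * exp (- (x/2) * s)))) \<partial>lborel)"
    proof (rule integral_mono)
      show "integrable lborel (\<lambda>s. norm ((c * s) ^ k * exp (c * s * x) * g s *
        (exp (c * s * ?h) - 1 - c * s * ?h)))"
        using integrable_norm[OF int'] unfolding eq .
      show "integrable lborel (\<lambda>s. ?h\<^sup>2 * (norm c ^ (k+2) * B *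
        (indicator {0<..} s * (s powr ((k+2) + \<beta>) * exp (- (x/2) * s)))))"
        using integrable_majorant[of "x/2" "k+2"] assms by (intro integrable_mult_right) auto
      fix s :: real
      show "norm ((c * s) ^ k * exp (c * s * x) * g s * (exp (c * s * ?h) - 1 - c * s * ?h)) \<le>
        ?h\<^sup>2 * (norm c ^ (k+2) * B *
        (indicator {0<..} s * (s powr ((k+2) + \<beta>) * exp (- (x/2) * s))))"
      proof (cases "s > 0")
        case True
        let ?w = "c * s * ?h"
        have nw: "norm ?w = norm c * s * \<bar>?h\<bar>" using True by (simp add: norm_mult del: of_real_diff)
        have "norm c * \<bar>?h\<bar> \<le> x / 2"
          using pos_less_divide_eq[THEN iffD1, OF _ y[unfolded d_def]] c1
          by (cases "c = 0") (auto simp: mult_ac)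
        then have ew: "exp (norm ?w) \<le> exp (s * x / 2)"
          unfolding nw using True mult_left_mono[of "norm c * \<bar>?h\<bar>" "x/2" s] by (simp add: mult_ac)
        have "norm ((c * s) ^ k * exp (c * s * x) * g s * (exp ?w - 1 - ?w)) \<le>
            norm c ^ k * s ^ k * exp (- s * x) * (B * s powr \<beta>) * (exp (s * x / 2) * (norm ?w)\<^sup>2)"
          unfolding norm_mult[of _ "exp ?w - 1 - ?w"]
        proof (intro mult_mono)
          show "norm ((c * s) ^ k * exp (c * s * x) * g s) \<le> norm c ^ k * s ^ k * exp (- s * x) * (B * s powr \<beta>)"
            using norm_integrand_le[of x x s k] True by (simp add: powr_add powr_realpow mult_ac)
          show "norm (exp ?w - 1 - ?w) \<le> exp (s * x / 2) * (norm ?w)\<^sup>2"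
            by (rule order.trans[OF norm_exp_minus_one_minus_le mult_right_mono[OF ew]]) auto
          show "0 \<le> norm c ^ k * s ^ k * exp (- s * x) * (B * s powr \<beta>)"
            using True order.trans[OF norm_ge_zero g_bound[of s]] by simp
        qed auto
        also have "\<dots> = ?h\<^sup>2 * (norm c ^ (k+2) * B * (s ^ (k+2) * s powr \<beta> * (exp (- s * x) * exp (s * x / 2))))"
          unfolding nw by (simp add: power_mult_distrib power_add power2_eq_square mult_ac)
        also have "exp (- s * x) * exp (s * x / 2) = exp (- (x/2) * s)"
          by (simp add: exp_add[symmetric] field_simps)
        also have "s ^ (k+2) * s powr \<beta> = s powr ((k+2) + \<beta>)"
          using True by (simp add: powr_add powr_realpow power_add power2_eq_square)
        finally show ?thesis using True by simp
      next
        case False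
        then have "g s = 0" using g_bound[of s] by simp
        then show ?thesis using False by simp
      qed
    qed
    also have "\<dots> = K * ?h\<^sup>2"
      unfolding K_def integral_mult_right_zero by (simp only: mult_ac)
    finally show ?thesis .
  qed
  have "((\<lambda>y. norm (H k y - H k x - (y - x) *\<^sub>R H (Suc k) x) / norm (y - x)) \<longlongrightarrow> 0) (at x)"
  proof (rule real_tendsto_sandwich[where f = "\<lambda>_. 0" and h = "\<lambda>y. K * \<bar>y - x\<bar>"])
    show "((\<lambda>y. K * \<bar>y - x\<bar>) \<longlongrightarrow> 0) (at x)"
      by (auto intro!: tendsto_eq_intros)
    have "\<forall>\<^sub>F y in at x. \<bar>y - x\<bar> < d"
      using d by (auto simp: eventually_at dist_real_def)
    then show "\<forall>\<^sub>F y in at x. norm (H k y - H k x - (y - x) *\<^sub>R H (Suc k) x) / norm (y - x) \<le> K * \<bar>y - x\<bar>"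
    proof eventually_elim
      case (elim y)
      show ?case
        using bound[OF elim] by (cases "y = x") (auto simp: divide_simps power2_eq_square abs_mult_self_eq mult_ac)
    qed
  qed auto
  then show ?thesis
    unfolding has_vector_derivative_def has_derivative_iff_norm
    by (simp add: bounded_linear_scaleR_left)
qed

end

section \<open>The inversion kernel on the sector and the contour rotation\<close>

text \<open>The closed sector of half-angle \<open>pi / 4\<close> with apex 0, described by linear
  inequalities. It contains the positive axis, and the ray of direction \<open>1 - \<i>\<close> is
  its lower edge.\<close>

definition sector :: "complex set" where
  "sector = {z. \<bar>Im z\<bar> \<le> Re z}"

text \<open>The argument of \<open>z\<close> is at most \<open>pi / 4\<close> in modulus, so that of
  the power is at most \<open>pi / 2\<close>. This is where \<open>\<alpha> \<le> 2\<close> enters,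
  and it dictates how far the contour may be rotated.\<close>

lemma Re_powr_sector_nonneg:
  fixes \<alpha> :: real
  assumes "z \<in> sector" "0 < \<alpha>" "\<alpha> \<le> 2"
  shows "Re (z powr \<alpha>) \<ge> 0"
proof (cases "z = 0")
  case False
  then have z: "Re z > 0" "\<bar>Im z\<bar> \<le> Re z"
    using assms(1) by (auto simp: sector_def complex_eq_iff)
  have "\<bar>arctan (Im z / Re z)\<bar> \<le> arctan 1"
    using z arctan_le_iff[of "Im z / Re z" 1] arctan_le_iff[of "-1" "Im z / Re z"]
    by (simp add: abs_le_iff arctan_minus field_simps)
  then have "\<bar>Im (Ln z)\<bar> \<le> pi / 4"
    using arg_conv_arctan[OF z(1)] Arg_eq_Im_Ln[OF False] by (simp add: arctan_one)
  then have "\<alpha> * \<bar>Im (Ln z)\<bar> \<le> 2 * (pi / 4)"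
    using assms by (intro mult_mono) auto
  then have "\<bar>\<alpha> * Im (Ln z)\<bar> \<le> pi / 2"
    using assms by (simp add: abs_mult)
  then have "cos (\<alpha> * Im (Ln z)) \<ge> 0"
    by (intro cos_ge_zero) (auto simp: abs_le_iff)
  then show ?thesis
    using False by (simp add: powr_def Re_exp)
qed simp

text \<open>The integrand of Levy's inversion formula for the interval from \<open>a\<close> to
  \<open>b\<close>, continued to complex frequencies, with 1 subtracted from the characteristic
  function.\<close>

definition increment_kernel :: "real \<Rightarrow> real \<Rightarrow> real \<Rightarrow> real \<Rightarrow> complex \<Rightarrow> complex" where
  "increment_kernel \<alpha> t a b z =
     (exp (- (\<i> * z * a)) - exp (- (\<i> * z * b))) / (\<i> * z) * (exp (- (t * z powr \<alpha>)) - 1)"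

text \<open>
  At \<open>z = 0\<close> the junk value \<open>x / 0 = 0\<close> makes the kernel \<open>0\<close>, which is also
  its limit there; so it is continuous on the closed sector and Cauchy's theorem applies to
  triangles with a vertex at the origin.
\<close>

lemma increment_kernel_tendsto_0:
  assumes "0 < \<alpha>" "\<alpha> \<le> 2" "0 \<le> t"
  shows "(increment_kernel \<alpha> t a b \<longlongrightarrow> 0) (at 0 within sector)"
proof -
  define h where "h = (\<lambda>z :: complex. (exp (- (\<i> * z * a)) - exp (- (\<i> * z * b))) / \<i>)"
  have "(h has_field_derivative of_real (b - a)) (at 0 within sector)"
    unfolding h_def by (auto intro!: derivative_eq_intros simp: algebra_simps)
  then have E: "((\<lambda>z. h z / z) \<longlongrightarrow> of_real (b - a)) (at 0 within sector)"
    by (simp add: has_field_derivative_iff h_def)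
  have "((\<lambda>z. exp (- (complex_of_real t * z powr \<alpha>)) - 1) \<longlongrightarrow> 0) (at 0 within sector)"
  proof (rule Lim_null_comparison)
    show "\<forall>\<^sub>F z in at 0 within sector.
        norm (exp (- (complex_of_real t * z powr \<alpha>)) - 1) \<le> t * norm z powr \<alpha>"
      unfolding eventually_at_topological
    proof (intro exI[of _ UNIV] conjI ballI impI)
      fix z assume "z \<in> sector"
      then have "norm (exp (- (t * z powr \<alpha>)) - 1) \<le> norm (t * z powr \<alpha>)"
        using assms Re_powr_sector_nonneg[of z \<alpha>] by (intro norm_exp_minus_one_le) simp
      then show "norm (exp (- (complex_of_real t * z powr \<alpha>)) - 1) \<le> t * norm z powr \<alpha>"
        using assms by (simp add: norm_mult norm_powr_real_powr')
    qed auto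
    have "((\<lambda>z. norm z powr \<alpha>) \<longlongrightarrow> 0) (at (0 :: complex) within sector)"
      by (rule tendsto_zero_powrI[where b = \<alpha>]) (use assms in \<open>auto intro!: tendsto_eq_intros\<close>)
    then show "((\<lambda>z. t * norm z powr \<alpha>) \<longlongrightarrow> 0) (at (0 :: complex) within sector)"
      by (rule tendsto_mult_right_zero)
  qed
  from tendsto_mult[OF E this] show ?thesis
    unfolding increment_kernel_def[abs_def] h_def divide_divide_eq_left by (simp only: mult_zero_right)
qed

lemma increment_kernel_field_differentiable:
  assumes "Re z > 0"
  shows "increment_kernel \<alpha> t a b field_differentiable (at z)"
proof (rule holomorphic_on_imp_differentiable_at)
  show "increment_kernel \<alpha> t a b holomorphic_on {z. Re z > 0}"
    unfolding increment_kernel_def[abs_def]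
    by (intro holomorphic_intros) (auto simp: complex_nonpos_Reals_iff)
qed (use assms in \<open>auto simp: open_halfspace_Re_gt\<close>)

lemma continuous_on_increment_kernel:
  assumes "0 < \<alpha>" "\<alpha> \<le> 2" "0 \<le> t"
  shows "continuous_on sector (increment_kernel \<alpha> t a b)"
proof (rule continuous_on_eq_continuous_within[THEN iffD2], rule ballI)
  fix z assume z: "z \<in> sector"
  show "continuous (at z within sector) (increment_kernel \<alpha> t a b)"
  proof (cases "z = 0")
    case True
    have "increment_kernel \<alpha> t a b 0 = 0" by (simp add: increment_kernel_def)
    with increment_kernel_tendsto_0[OF assms, of a b] show ?thesis
      unfolding True continuous_within by (simp only:)
  next
    case False
    then have "Re z > 0" using z by (auto simp: sector_def complex_eq_iff)
    then show ?thesis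
      by (rule continuous_at_imp_continuous_at_within[OF field_differentiable_imp_continuous_at[OF
            increment_kernel_field_differentiable]])
  qed
qed

lemma convex_sector: "convex sector"
proof (rule convexI)
  fix x y :: complex and u v :: real
  assume "x \<in> sector" "y \<in> sector" "0 \<le> u" "0 \<le> v"
  then have "u * \<bar>Im x\<bar> \<le> u * Re x" "v * \<bar>Im y\<bar> \<le> v * Re y"
    by (auto simp: sector_def mult_left_mono)
  moreover have "\<bar>u * Im x + v * Im y\<bar> \<le> u * \<bar>Im x\<bar> + v * \<bar>Im y\<bar>"
    using abs_triangle_ineq[of "u * Im x" "v * Im y"] \<open>0 \<le> u\<close> \<open>0 \<le> v\<close> by (simp add: abs_mult)
  ultimately show "u *\<^sub>R x + v *\<^sub>R y \<in> sector" by (simp add: sector_def)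
qed

text \<open>Cauchy's theorem on the right triangle with vertices 0, \<open>T\<close> and
  \<open>(1 - \<i>) * T\<close>, which lies in the sector by convexity.\<close>

lemma contour_integral_increment_kernel_triangle:
  fixes a b T :: real
  assumes "0 < \<alpha>" "\<alpha> \<le> 2" "0 \<le> t" "0 < T"
  defines "G \<equiv> increment_kernel \<alpha> t a b"
  shows "contour_integral (linepath 0 (of_real T)) G =
      contour_integral (linepath 0 ((1 - \<i>) * T)) G
      - contour_integral (linepath (of_real T) ((1 - \<i>) * T)) G"
    and "G contour_integrable_on linepath 0 (of_real T)"
    and "G contour_integrable_on linepath 0 ((1 - \<i>) * T)"
    and "G contour_integrable_on linepath (of_real T) ((1 - \<i>) * T)"
proof -
  let ?P = "(1 - \<i>) * T :: complex"
  let ?S = "convex hull {0, complex_of_real T, ?P}"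
  have sub: "?S \<subseteq> sector"
    using assms convex_sector by (intro hull_minimal) (auto simp: sector_def)
  have cont: "continuous_on ?S G"
    unfolding G_def using continuous_on_increment_kernel[OF assms(1-3)] sub
    by (rule continuous_on_subset)
  have seg: "closed_segment 0 (complex_of_real T) \<subseteq> ?S" "closed_segment (complex_of_real T) ?P \<subseteq> ?S"
    "closed_segment ?P 0 \<subseteq> ?S"
    by (rule segments_subset_convex_hull)+
  show i1: "G contour_integrable_on linepath 0 (of_real T)"
    by (rule contour_integrable_continuous_linepath[OF continuous_on_subset[OF cont seg(1)]])
  show i2: "G contour_integrable_on linepath (of_real T) ?P"
    by (rule contour_integrable_continuous_linepath[OF continuous_on_subset[OF cont seg(2)]])
  have i3: "G contour_integrable_on linepath ?P 0"
    by (rule contour_integrable_continuous_linepath[OF continuous_on_subset[OF cont seg(3)]])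
  show "G contour_integrable_on linepath 0 ?P"
    using i3 by (rule contour_integrable_reversepath[of "linepath ?P 0", simplified, rotated])
  have "(G has_contour_integral 0) (linepath 0 (of_real T) +++ linepath (of_real T) ?P +++ linepath ?P 0)"
  \<comment> \<open>With 0 listed as exceptional, every remaining point of the triangle has positive
    real part, hence avoids the branch cut and the zero denominator.\<close>
  proof (rule Cauchy_theorem_triangle_cofinite[OF cont, of "{0}"])
    fix z assume "z \<in> interior ?S - {0}"
    then have "z \<in> sector" "z \<noteq> 0" using interior_subset sub by auto
    then have "Re z > 0" by (auto simp: sector_def complex_eq_iff)
    then show "G field_differentiable (at z)"
      unfolding G_def by (rule increment_kernel_field_differentiable)
  qed auto
  from contour_integral_unique[OF this]
  have "0 = contour_integral (linepath 0 (of_real T)) G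
      + (contour_integral (linepath (of_real T) ?P) G + contour_integral (linepath ?P 0) G)"
    by (simp add: i1 i2 i3)
  moreover have "contour_integral (linepath ?P 0) G = - contour_integral (linepath 0 ?P) G"
    using contour_integral_reversepath[of "linepath 0 ?P" G] by simp
  ultimately show "contour_integral (linepath 0 (of_real T)) G =
      contour_integral (linepath 0 ?P) G - contour_integral (linepath (of_real T) ?P) G"
    by (simp add: algebra_simps)
qed

text \<open>At \<open>z = T - \<i> * T * y\<close> both exponentials are at most
  \<open>exp (- a * T * y)\<close>, their difference is at most twice that, the last factor is at
  most 2, and \<open>norm z \<ge> T\<close> cancels the length of the side. Integrating
  \<open>4 * exp (- a * T * y)\<close> over the unit interval gives at most
  \<open>4 / (a * T)\<close>; this needs \<open>a > 0\<close>.\<close>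

lemma vertical_contour_integral_tendsto_0:
  fixes a b :: real
  assumes "0 < \<alpha>" "\<alpha> \<le> 2" "0 \<le> t" "0 < a" "a \<le> b"
  defines "G \<equiv> increment_kernel \<alpha> t a b"
  shows "((\<lambda>T. contour_integral (linepath (of_real T) ((1 - \<i>) * of_real T)) G) \<longlongrightarrow> 0) at_top"
proof (rule Lim_null_comparison)
  show "((\<lambda>T. 4 / (a * T)) \<longlongrightarrow> 0) at_top"
    using assms by (auto intro!: real_tendsto_divide_at_top filterlim_tendsto_pos_mult_at_top
        filterlim_ident tendsto_const)
  show "\<forall>\<^sub>F T in at_top. norm (contour_integral (linepath (of_real T) ((1 - \<i>) * of_real T)) G) \<le> 4 / (a * T)"
    using eventually_gt_at_top[of 0]
  proof eventually_elim
    case (elim T)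
    let ?P = "(1 - \<i>) * of_real T :: complex"
    have "(G has_contour_integral contour_integral (linepath (of_real T) ?P) G) (linepath (of_real T) ?P)"
      using contour_integral_increment_kernel_triangle(4)[OF assms(1-3) elim]
      by (simp add: G_def has_contour_integral_integral)
    then have I: "((\<lambda>y. G (linepath (of_real T) ?P y) * (?P - of_real T)) has_integral
        contour_integral (linepath (of_real T) ?P) G) {0..1}"
      by (simp add: has_contour_integral_linepath)
    have J: "((\<lambda>y. 4 * exp (- (a * T) * y)) has_integral
        (4 * exp (- (a * T) * 1) / (- (a * T)) - 4 * exp (- (a * T) * 0) / (- (a * T)))) {0..1}"
      using assms elim by (intro fundamental_theorem_of_calculus)
        (auto intro!: derivative_eq_intros simp: has_real_derivative_iff_has_vector_derivative[symmetric])
    have "norm (integral {0..1} (\<lambda>y. G (linepath (of_real T) ?P y) * (?P - of_real T)))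
        \<le> integral {0..1} (\<lambda>y. 4 * exp (- (a * T) * y))"
    proof (rule integral_norm_bound_integral)
      fix y :: real assume y: "y \<in> {0..1}"
      let ?z = "linepath (complex_of_real T) ?P y"
      have z: "Re ?z = T" "Im ?z = - (T * y)"
        by (simp_all add: linepath_def algebra_simps)
      have zs: "?z \<in> sector" using y elim z by (simp add: sector_def abs_mult mult_left_le)
      have "norm ?z \<ge> T" using abs_Re_le_cmod[of ?z] z elim by simp
      have "norm (exp (- (t * ?z powr \<alpha>))) \<le> 1"
        using Re_powr_sector_nonneg[OF zs assms(1,2)] assms by simp
      then have e1: "norm (exp (- (t * ?z powr \<alpha>)) - 1) \<le> 2"
        by (intro order.trans[OF norm_triangle_ineq4]) simp
      have "norm (exp (- (\<i> * ?z * a)) - exp (- (\<i> * ?z * b))) \<le> exp (- (T * y) * a) + exp (- (T * y) * b)"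
        using norm_triangle_ineq4[of "exp (- (\<i> * ?z * a))" "exp (- (\<i> * ?z * b))"] z by simp
      also have "exp (- (T * y) * b) \<le> exp (- (T * y) * a)"
        using assms elim y by (simp add: mult_left_mono)
      finally have e2: "norm (exp (- (\<i> * ?z * a)) - exp (- (\<i> * ?z * b))) \<le> 2 * exp (- (a * T) * y)"
        by (simp add: mult_ac)
      have "norm (G ?z) = norm (exp (- (\<i> * ?z * a)) - exp (- (\<i> * ?z * b))) / norm ?z *
          norm (exp (- (t * ?z powr \<alpha>)) - 1)"
        by (simp add: G_def increment_kernel_def norm_mult norm_divide)
      also have "\<dots> \<le> (2 * exp (- (a * T) * y)) / T * 2"
        using e1 e2 \<open>norm ?z \<ge> T\<close> elim by (intro mult_mono frac_le) auto
      finally have "norm (G ?z) * T \<le> (2 * exp (- (a * T) * y)) / T * 2 * T"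
        using elim by (intro mult_right_mono) auto
      moreover have "norm (?P - of_real T) = T"
        using elim by (simp add: algebra_simps norm_mult)
      ultimately show "norm (G ?z * (?P - of_real T)) \<le> 4 * exp (- (a * T) * y)"
        using elim unfolding norm_mult by simp
    qed (rule has_integral_integrable[OF I] has_integral_integrable[OF J])+
    also have "\<dots> = 4 / (a * T) - 4 * exp (- (a * T)) / (a * T)"
      using integral_unique[OF J] by simp
    also have "\<dots> \<le> 4 / (a * T)"
      using assms elim by simp
    finally show ?case using integral_unique[OF I] by simp
  qed
qed

section \<open>The limit integral along the rotated ray\<close>

text \<open>What remains of the kernel on the ray, Jacobian included, once the exponentials in
  \<open>a\<close> and \<open>b\<close> are split off. The value 0 for \<open>s \<le> 0\<close> is
  what \<open>laplace_weight\<close> requires.\<close>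

definition ray_weight :: "real \<Rightarrow> real \<Rightarrow> real \<Rightarrow> complex" where
  "ray_weight \<alpha> t s =
     (if s \<in> {0<..} then (exp (- (t * ((1 - \<i>) * s) powr \<alpha>)) - 1) / (\<i> * s) else 0)"

text \<open>Apply \<open>norm_exp_minus_one_le\<close> to \<open>t * z powr \<alpha>\<close>. The
  point of the ray at parameter \<open>s\<close> has modulus \<open>sqrt 2 * s\<close>, whence the
  constant, and division by \<open>s\<close> lowers the exponent to
  \<open>\<alpha> - 1 > -1\<close>.\<close>

lemma laplace_weight_ray:
  assumes "0 < \<alpha>" "\<alpha> \<le> 2" "0 \<le> t"
  shows "laplace_weight (- (1 + \<i>)) (ray_weight \<alpha> t) (t * sqrt 2 powr \<alpha>) (\<alpha> - 1)"
proof
  show "ray_weight \<alpha> t \<in> borel_measurable borel"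
    unfolding ray_weight_def
    by (intro borel_measurable_continuous_on_if)
       (auto intro!: continuous_intros simp: complex_nonpos_Reals_iff complex_eq_iff)
  show "norm (ray_weight \<alpha> t s) \<le> t * sqrt 2 powr \<alpha> * (indicator {0<..} s * s powr (\<alpha> - 1))" for s
  proof (cases "s > 0")
    case True
    let ?z = "(1 - \<i>) * s :: complex"
    have "?z \<in> sector" using True by (simp add: sector_def)
    then have "norm (exp (- (t * ?z powr \<alpha>)) - 1) \<le> norm (t * ?z powr \<alpha>)"
      using assms Re_powr_sector_nonneg[of ?z \<alpha>] by (intro norm_exp_minus_one_le) simp
    also have "\<dots> = t * norm ?z powr \<alpha>"
      using assms by (simp add: norm_mult norm_powr_real_powr')
    also have "norm ?z = sqrt 2 * s"
      using True by (simp add: norm_mult cmod_def real_sqrt_mult)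
    finally have "norm (exp (- (t * ?z powr \<alpha>)) - 1) / s \<le> t * (sqrt 2 * s) powr \<alpha> / s"
      using True by (intro divide_right_mono) auto
    also have "\<dots> = t * sqrt 2 powr \<alpha> * s powr (\<alpha> - 1)"
      using True by (simp add: powr_mult powr_diff)
    finally show ?thesis
      using True by (simp add: ray_weight_def norm_divide norm_mult)
  qed (simp add: ray_weight_def)
qed (use assms in auto)

abbreviation ray_transform :: "real \<Rightarrow> real \<Rightarrow> nat \<Rightarrow> real \<Rightarrow> complex" where
  "ray_transform \<alpha> t \<equiv> laplace_weight.H (- (1 + \<i>)) (ray_weight \<alpha> t)"

text \<open>The Jacobian \<open>1 - \<i>\<close> cancels the same factor in the denominator, and
  \<open>\<i> * (1 - \<i>) = 1 + \<i>\<close> turns oscillation into decay. At \<open>s = 0\<close>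
  both sides are 0 by convention.\<close>

lemma increment_kernel_on_ray:
  assumes "s \<ge> 0"
  shows "increment_kernel \<alpha> t a b ((1 - \<i>) * s) * (1 - \<i>) =
    exp (- (1 + \<i>) * s * a) * ray_weight \<alpha> t s - exp (- (1 + \<i>) * s * b) * ray_weight \<alpha> t s"
proof (cases "s = 0")
  case False
  have "\<i> * ((1 - \<i>) * s) = (1 + \<i>) * s" by (simp add: algebra_simps)
  then have *: "- (\<i> * ((1 - \<i>) * s) * x) = - (1 + \<i>) * s * x" for x :: complex
    by (simp only: minus_mult_left)
  have ne: "1 - \<i> \<noteq> 0" by (simp add: complex_eq_iff)
  have **: "X / (\<i> * ((1 - \<i>) * s)) * Y * (1 - \<i>) = X * (Y / (\<i> * s))" for X Y :: complex
    using False ne by (simp add: divide_simps)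
  show ?thesis
    unfolding increment_kernel_def * ** ray_weight_def using assms False
    by (simp only: left_diff_distrib) simp
qed (simp add: increment_kernel_def ray_weight_def)

text \<open>Rescaling the path parameter by \<open>T\<close> turns the contour integral into the
  integral of \<open>F\<close> truncated at \<open>T\<close>; as \<open>F\<close> is integrable on
  the line, the truncations converge.\<close>

lemma diagonal_contour_integral_tendsto:
  fixes a b :: real
  assumes "0 < \<alpha>" "\<alpha> \<le> 2" "0 \<le> t" "0 < a" "a \<le> b"
  shows "((\<lambda>T. contour_integral (linepath 0 ((1 - \<i>) * of_real T)) (increment_kernel \<alpha> t a b))
    \<longlongrightarrow> ray_transform \<alpha> t 0 a - ray_transform \<alpha> t 0 b) at_top"
proof -
  interpret laplace_weight "- (1 + \<i>)" "ray_weight \<alpha> t" "t * sqrt 2 powr \<alpha>" "\<alpha> - 1"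
    by (rule laplace_weight_ray[OF assms(1-3)])
  let ?G = "increment_kernel \<alpha> t a b"
  define F where "F s = exp (- (1 + \<i>) * of_real s * of_real a) * ray_weight \<alpha> t s
    - exp (- (1 + \<i>) * of_real s * of_real b) * ray_weight \<alpha> t s" for s :: real
  have F0: "F s = 0" if "s \<le> 0" for s using that by (simp add: F_def ray_weight_def)
  have ia: "integrable lborel (\<lambda>s. exp (- (1 + \<i>) * of_real s * of_real a) * ray_weight \<alpha> t s)"
    using integrable_integrand[of a 0] assms by simp
  have ib: "integrable lborel (\<lambda>s. exp (- (1 + \<i>) * of_real s * of_real b) * ray_weight \<alpha> t s)"
    using integrable_integrand[of b 0] assms by simp
  have F: "integrable lborel F"
    unfolding F_def[abs_def] by (rule Bochner_Integration.integrable_diff[OF ia ib])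
  have intF: "integral\<^sup>L lborel F = H 0 a - H 0 b"
    unfolding F_def[abs_def] H_def using Bochner_Integration.integral_diff[OF ia ib] by simp
  have "((\<lambda>T. \<integral>s. indicator {..T} s *\<^sub>R F s \<partial>lborel) \<longlongrightarrow> H 0 a - H 0 b) at_top"
    unfolding intF[symmetric] by (rule tendsto_integral_at_top) (auto simp: F)
  moreover have "\<forall>\<^sub>F T in at_top. (\<integral>s. indicator {..T} s *\<^sub>R F s \<partial>lborel) =
      contour_integral (linepath 0 ((1 - \<i>) * of_real T)) ?G"
    using eventually_gt_at_top[of 0]
  proof eventually_elim
    case (elim T)
    let ?P = "(1 - \<i>) * of_real T :: complex"
    have "(?G has_contour_integral contour_integral (linepath 0 ?P) ?G) (linepath 0 ?P)"
      using contour_integral_increment_kernel_triangle(3)[OF assms(1-3) elim]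
      by (simp add: has_contour_integral_integral)
    then have I: "((\<lambda>x. ?G (linepath 0 ?P x) * ?P) has_integral contour_integral (linepath 0 ?P) ?G) {0..1}"
      by (simp add: has_contour_integral_linepath)
    have eq: "?G (linepath 0 ?P x) * ?P = T *\<^sub>R F (T * x)" if "x \<in> {0..1}" for x
    proof -
      have "linepath 0 ?P x = (1 - \<i>) * of_real (T * x)"
        by (simp add: linepath_def scaleR_conv_of_real mult_ac)
      moreover have "?G ((1 - \<i>) * of_real (T * x)) * (1 - \<i>) = F (T * x)"
        unfolding F_def using that elim by (intro increment_kernel_on_ray) auto
      ultimately have "?G (linepath 0 ?P x) * ?P = F (T * x) * of_real T"
        by (simp only: mult.assoc[symmetric])
      then show ?thesis by (simp only: scaleR_conv_of_real mult.commute)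
    qed
    have int: "set_integrable lborel {0..1} (\<lambda>x. T *\<^sub>R F (T * x))"
      unfolding set_integrable_def
      using lborel_integrable_real_affine[OF F, of T 0] elim
      by (intro integrable_mult_indicator integrable_scaleR_right) auto
    have "(\<integral>s. indicator {..T} s *\<^sub>R F s \<partial>lborel) =
        \<bar>T\<bar> *\<^sub>R (\<integral>x. indicator {..T} (0 + T * x) *\<^sub>R F (0 + T * x) \<partial>lborel)"
      using elim by (intro lborel_integral_real_affine) auto
    also have "\<dots> = (\<integral>x. T *\<^sub>R (indicator {..T} (T * x) *\<^sub>R F (T * x)) \<partial>lborel)"
      by (simp only: abs_of_pos[OF elim] add_0 integral_scaleR_right)
    also have "\<dots> = (LINT x:{0..1}|lborel. T *\<^sub>R F (T * x))"
      unfolding set_lebesgue_integral_def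
    proof (rule Bochner_Integration.integral_cong[OF refl])
      fix x :: real
      \<comment> \<open>The cutoff at \<open>T\<close> has no lower end; for \<open>x < 0\<close> it
        is the vanishing of \<open>F\<close> that makes the sides agree.\<close>
      show "T *\<^sub>R (indicator {..T} (T * x) *\<^sub>R F (T * x)) = indicator {0..1} x *\<^sub>R (T *\<^sub>R F (T * x))"
        using elim F0[of "T * x"] by (cases "x < 0") (auto simp: indicator_def mult_le_0_iff)
    qed
    also have "\<dots> = integral {0..1} (\<lambda>x. T *\<^sub>R F (T * x))"
      by (rule set_borel_integral_eq_integral(2)[OF int])
    also have "\<dots> = integral {0..1} (\<lambda>x. ?G (linepath 0 ?P x) * ?P)"
      by (rule Henstock_Kurzweil_Integration.integral_cong) (simp only: eq)
    also have "\<dots> = contour_integral (linepath 0 ?P) ?G"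
      by (rule integral_unique[OF I])
    finally show ?case .
  qed
  ultimately show ?thesis by (rule Lim_transform_eventually)
qed

lemma increment_kernel_integral_tendsto:
  fixes a b :: real
  assumes "0 < \<alpha>" "\<alpha> \<le> 2" "0 \<le> t" "0 < a" "a \<le> b"
  shows "((\<lambda>T. integral {0..T} (\<lambda>u. increment_kernel \<alpha> t a b (of_real u)))
    \<longlongrightarrow> ray_transform \<alpha> t 0 a - ray_transform \<alpha> t 0 b) at_top"
proof -
  let ?G = "increment_kernel \<alpha> t a b"
  have "((\<lambda>T. contour_integral (linepath 0 ((1 - \<i>) * of_real T)) ?G
      - contour_integral (linepath (of_real T) ((1 - \<i>) * of_real T)) ?G)
    \<longlongrightarrow> ray_transform \<alpha> t 0 a - ray_transform \<alpha> t 0 b - 0) at_top"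
    by (rule tendsto_diff[OF diagonal_contour_integral_tendsto[OF assms]
          vertical_contour_integral_tendsto_0[OF assms]])
  then have "((\<lambda>T. contour_integral (linepath 0 ((1 - \<i>) * of_real T)) ?G
      - contour_integral (linepath (of_real T) ((1 - \<i>) * of_real T)) ?G)
    \<longlongrightarrow> ray_transform \<alpha> t 0 a - ray_transform \<alpha> t 0 b) at_top"
    by (simp only: diff_zero)
  moreover have "\<forall>\<^sub>F T in at_top. contour_integral (linepath 0 ((1 - \<i>) * of_real T)) ?G
      - contour_integral (linepath (of_real T) ((1 - \<i>) * of_real T)) ?G =
      integral {0..T} (\<lambda>u. ?G (of_real u))"
    using eventually_gt_at_top[of 0]
  proof eventually_elim
    case (elim T)
    show ?case
      unfolding contour_integral_increment_kernel_triangle(1)[OF assms(1-3) elim, of a b, symmetric]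
      using contour_integral_linepath_Reals_eq[of 0 "of_real T" ?G] elim by simp
  qed
  ultimately show ?thesis by (rule Lim_transform_eventually)
qed

section \<open>Levy inversion and the sine integrals\<close>

text \<open>Take real parts in Levy's inversion formula. For real even \<open>\<phi>\<close> the
  real part of the integrand is even, so the symmetric integral is twice the one over the positive
  side and \<open>1 / (2 * pi)\<close> becomes \<open>1 / pi\<close>. Writing the quotients with
  \<open>sinc\<close> removes the singularity at 0. The signs of \<open>a\<close> and
  \<open>b\<close> are free, so negative intervals are covered too.\<close>

lemma levy_inversion_real:
  fixes \<phi> :: "real \<Rightarrow> real" and a b :: real
  assumes "real_distribution \<mu>" "\<And>u. char \<mu> u = of_real (\<phi> u)"
    and "\<And>u. \<phi> (- u) = \<phi> u" "continuous_on UNIV \<phi>"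
    and "a \<le> b" "measure \<mu> {a} = 0" "measure \<mu> {b} = 0"
  shows "(\<lambda>n. integral {0..real n} (\<lambda>u. (b * sinc (u * b) - a * sinc (u * a)) * \<phi> u))
    \<longlonglongrightarrow> pi * measure \<mu> {a<..b}"
proof -
  interpret real_distribution \<mu> by fact
  define f where "f u = (iexp (- (u * a)) - iexp (- (u * b))) / (\<i> * of_real u) * char \<mu> u" for u :: real
  define R where "R u = (b * sinc (u * b) - a * sinc (u * a)) * \<phi> u" for u :: real
  have contR: "continuous_on S R" for S
    unfolding R_def[abs_def]
    by (intro continuous_intros continuous_on_subset[OF assms(4)]
        continuous_on_compose2[OF continuous_on_sinc[OF continuous_on_id], where s = UNIV]) auto
  have Re_f: "Re (f u) = R u" if "u \<noteq> 0" for u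
  proof -
    have "(iexp (- (u * a)) - iexp (- (u * b))) / (\<i> * of_real u) =
        of_real ((sin (u * b) - sin (u * a)) / u) + \<i> * of_real ((cos (u * b) - cos (u * a)) / u)"
      using that by (simp add: complex_eq_iff exp_eq_polar cis.ctr Re_divide Im_divide power2_eq_square field_simps)
    then have "Re (f u) = (sin (u * b) - sin (u * a)) / u * \<phi> u"
      unfolding f_def assms(2) by simp
    also have "\<dots> = R u"
      using that by (auto simp: R_def field_simps)
    finally show ?thesis .
  qed
  have Re_int: "Re (CLBINT u=-real n..real n. f u) = 2 * integral {0..real n} R" for n
  proof -
    have int: "set_integrable lborel {- real n..real n} f"
      unfolding set_integrable_def
    proof (rule Bochner_Integration.integrable_bound)
      show "integrable lborel (\<lambda>u. (b - a) * indicator {- real n..real n} u)" by simp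
      show "AE u in lborel. norm (indicator {- real n..real n} u *\<^sub>R f u) \<le>
          norm ((b - a) * indicator {- real n..real n} u)"
      proof (intro AE_I2)
        fix u :: real
        have "norm (f u) \<le> b - a"
        proof (cases "u = 0")
          case False
          have "norm (f u) = norm ((iexp (u * - a) - iexp (u * - b)) / (\<i> * of_real u)) * norm (char \<mu> u)"
            by (simp only: f_def norm_mult mult_minus_right)
          \<comment> \<open>The auxiliary bound is used with the reflected endpoints
            \<open>- b \<le> - a\<close>, because the inversion formula carries a minus sign in the
            exponents.\<close>
          also have "\<dots> \<le> (- a - - b) * 1"
            using assms False cmod_char_le_1[of u] by (intro mult_mono Levy_Inversion_aux2) auto
          finally show ?thesis by simp
        qed (use assms in \<open>simp add: f_def\<close>)
        then show "norm (indicator {- real n..real n} u *\<^sub>R f u) \<le>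
            norm ((b - a) * indicator {- real n..real n} u)"
          using assms by (auto simp: indicator_def)
      qed
      show "(\<lambda>u. indicator {- real n..real n} u *\<^sub>R f u) \<in> borel_measurable lborel"
        unfolding f_def[abs_def] by measurable
    qed
    have "Re (CLBINT u=-real n..real n. f u) = Re (LINT u:{- real n..real n}|lborel. f u)"
      by (subst interval_integral_Icc) auto
    also have "\<dots> = (LINT u:{- real n..real n}|lborel. Re (f u))"
      using int unfolding set_integrable_def set_lebesgue_integral_def
      by (subst integral_Re[symmetric]) auto
    also have "\<dots> = (LINT u:{- real n..real n}|lborel. R u)"
      unfolding set_lebesgue_integral_def
    proof (rule integral_cong_AE)
      \<comment> \<open>At 0 division by zero gives \<open>f\<close> the value 0, whereas
        \<open>R\<close> has its continuous extension there; a single point is null.\<close>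
      show "AE u in lborel. indicator {- real n..real n} u *\<^sub>R Re (f u) = indicator {- real n..real n} u *\<^sub>R R u"
        using AE_lborel_singleton[of 0] by eventually_elim (simp add: Re_f)
      show "(\<lambda>u. indicator {- real n..real n} u *\<^sub>R R u) \<in> borel_measurable lborel"
        using contR by (auto intro!: borel_measurable_continuous_on_indicator simp del: real_scaleR_def)
    qed (unfold f_def, measurable)
    also have "\<dots> = integral {- real n..real n} R"
      by (intro set_borel_integral_eq_integral borel_integrable_atLeastAtMost' contR)
    also have "\<dots> = integral {- real n..0} R + integral {0..real n} R"
      by (intro Henstock_Kurzweil_Integration.integral_combine[symmetric] integrable_continuous_real contR) auto
    also have "integral {- real n..0} R = integral {0..real n} (\<lambda>u. R (- u))"
      using Henstock_Kurzweil_Integration.integral_reflect_real[of "real n" 0 "\<lambda>u. R (- u)"] by simp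
    also have "(\<lambda>u. R (- u)) = R"
      using assms(3) by (auto simp: R_def fun_eq_iff)
    finally show ?thesis by simp
  qed
  have "(\<lambda>n. Re (1 / (2 * pi) * (CLBINT u=-real n..real n. f u))) \<longlonglongrightarrow> Re (of_real (measure \<mu> {a<..b}))"
    unfolding f_def using Levy_Inversion[OF assms(5-7)] by (intro tendsto_Re) simp
  then have "(\<lambda>n. pi * Re (1 / (2 * pi) * (CLBINT u=-real n..real n. f u))) \<longlonglongrightarrow> pi * measure \<mu> {a<..b}"
    by (intro tendsto_mult tendsto_const) simp
  moreover have "pi * Re (1 / (2 * pi) * (CLBINT u=-real n..real n. f u)) = integral {0..real n} R" for n
  proof -
    have "Re (1 / (2 * pi) * (CLBINT u=-real n..real n. f u)) = 1 / (2 * pi) * Re (CLBINT u=-real n..real n. f u)"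
      by (simp only: scaleR_conv_of_real[symmetric] scaleR_complex.sel real_scaleR_def)
    then show ?thesis unfolding Re_int by simp
  qed
  ultimately show ?thesis unfolding R_def by simp
qed

text \<open>\<open>Si (u * a)\<close> is an antiderivative, so the integral is
  \<open>Si (T * a)\<close>. The limit does not depend on \<open>a > 0\<close>, which is why two
  such integrals cancel.\<close>

lemma integral_sinc_scale_tendsto:
  fixes a :: real
  assumes "a > 0"
  shows "((\<lambda>T. integral {0..T} (\<lambda>u. a * sinc (u * a))) \<longlongrightarrow> pi / 2) at_top"
proof -
  have "((\<lambda>T. Si (T * a)) \<longlongrightarrow> pi / 2) at_top"
    by (rule filterlim_compose[OF Si_at_top])
       (use assms in \<open>auto intro!: filterlim_at_top_mult_tendsto_pos filterlim_ident tendsto_const\<close>)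
  moreover have "\<forall>\<^sub>F T in at_top. Si (T * a) = integral {0..T} (\<lambda>u. a * sinc (u * a))"
    using eventually_ge_at_top[of 0]
  proof eventually_elim
    case (elim T)
    have "((\<lambda>u. a * sinc (u * a)) has_integral (Si (T * a) - Si (0 * a))) {0..T}"
    proof (rule fundamental_theorem_of_calculus[OF elim])
      fix u :: real
      have "((\<lambda>u. Si (u * a)) has_real_derivative sinc (u * a) * a) (at u)"
        by (rule DERIV_chain2[OF DERIV_Si]) (auto intro!: derivative_eq_intros)
      then show "((\<lambda>u. Si (u * a)) has_vector_derivative a * sinc (u * a)) (at u within {0..T})"
        by (simp add: has_real_derivative_iff_has_vector_derivative has_vector_derivative_at_within mult.commute)
    qed
    moreover have "Si 0 = 0"
      unfolding Si_def zero_ereal_def[symmetric] by simp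
    ultimately have "((\<lambda>u. a * sinc (u * a)) has_integral Si (T * a)) {0..T}"
      by (simp only: mult_zero_left diff_zero)
    then show ?case by (rule integral_unique[symmetric])
  qed
  ultimately show ?thesis by (rule Lim_transform_eventually)
qed

text \<open>On the positive axis the real part of the kernel is the inversion integrand minus the
  same expression with \<open>exp\<close> replaced by 1. Adding back the latter adds a difference of
  two sine integrals, which tends to \<open>pi / 2 - pi / 2\<close>.\<close>

lemma stable_interval_integral_tendsto:
  fixes a b :: real
  assumes "0 < \<alpha>" "\<alpha> \<le> 2" "0 \<le> t" "0 < a" "a \<le> b"
  shows "((\<lambda>T. integral {0..T} (\<lambda>u. (b * sinc (u * b) - a * sinc (u * a)) * exp (- t * \<bar>u\<bar> powr \<alpha>)))
    \<longlongrightarrow> Re (ray_transform \<alpha> t 0 a - ray_transform \<alpha> t 0 b)) at_top"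
proof -
  let ?G = "increment_kernel \<alpha> t a b"
  let ?S = "\<lambda>c T. integral {0..T} (\<lambda>u. c * sinc (u * c))"
  have cs: "continuous_on S (\<lambda>u. c * sinc (u * c))" for S and c :: real
    by (intro continuous_intros continuous_on_compose2[OF continuous_on_sinc[OF continuous_on_id], where s = UNIV])
  have "((\<lambda>T. Re (integral {0..T} (\<lambda>u. ?G (of_real u))) + (?S b T - ?S a T))
      \<longlongrightarrow> Re (ray_transform \<alpha> t 0 a - ray_transform \<alpha> t 0 b) + (pi / 2 - pi / 2)) at_top"
    using assms by (intro tendsto_add tendsto_diff tendsto_Re increment_kernel_integral_tendsto
        integral_sinc_scale_tendsto) auto
  then have "((\<lambda>T. Re (integral {0..T} (\<lambda>u. ?G (of_real u))) + (?S b T - ?S a T))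
      \<longlongrightarrow> Re (ray_transform \<alpha> t 0 a - ray_transform \<alpha> t 0 b)) at_top"
    by (simp only: diff_self add_0_right)
  moreover have "\<forall>\<^sub>F T in at_top. Re (integral {0..T} (\<lambda>u. ?G (of_real u))) + (?S b T - ?S a T) =
      integral {0..T} (\<lambda>u. (b * sinc (u * b) - a * sinc (u * a)) * exp (- t * \<bar>u\<bar> powr \<alpha>))"
    using eventually_gt_at_top[of 0]
  proof eventually_elim
    case (elim T)
    have "continuous_on {0..T} (\<lambda>u. ?G (of_real u))"
      by (intro continuous_on_compose2[OF continuous_on_increment_kernel[OF assms(1-3)]] continuous_intros)
         (auto simp: sector_def)
    then have "(\<lambda>u. ?G (of_real u)) integrable_on {0..T}"
      by (rule integrable_continuous_real)
    then have "((\<lambda>u. Re (?G (of_real u))) has_integral Re (integral {0..T} (\<lambda>u. ?G (of_real u)))) {0..T}"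
      by (intro has_integral_Re integrable_integral)
    moreover have "((\<lambda>u. c * sinc (u * c)) has_integral ?S c T) {0..T}" for c
      by (intro integrable_integral integrable_continuous_real cs)
    ultimately have "((\<lambda>u. Re (?G (of_real u)) + (b * sinc (u * b) - a * sinc (u * a))) has_integral
        Re (integral {0..T} (\<lambda>u. ?G (of_real u))) + (?S b T - ?S a T)) {0..T}"
      by (intro has_integral_add has_integral_diff)
    then have "((\<lambda>u. (b * sinc (u * b) - a * sinc (u * a)) * exp (- t * \<bar>u\<bar> powr \<alpha>)) has_integral
        Re (integral {0..T} (\<lambda>u. ?G (of_real u))) + (?S b T - ?S a T)) {0..T}"
    proof (rule has_integral_spike[of "{0}", rotated 2])
      fix u assume u: "u \<in> {0..T} - {0}"
      then have "u > 0" by auto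
      have p: "complex_of_real u powr of_real \<alpha> = of_real (u powr \<alpha>)"
        using u by (simp add: powr_of_real)
      have e: "exp (- (of_real t * complex_of_real u powr of_real \<alpha>)) - 1 =
          complex_of_real (exp (- t * u powr \<alpha>) - 1)"
        unfolding p by (simp add: exp_of_real[symmetric])
      have q: "(exp (- (\<i> * of_real u * of_real a)) - exp (- (\<i> * of_real u * of_real b))) / (\<i> * of_real u) =
        of_real ((sin (u * b) - sin (u * a)) / u) + \<i> * of_real ((cos (u * b) - cos (u * a)) / u)"
        using \<open>u > 0\<close> by (simp add: complex_eq_iff Re_exp Im_exp Re_divide Im_divide power2_eq_square field_simps)
      have "Re (?G (of_real u)) = (sin (u * b) - sin (u * a)) / u * (exp (- t * u powr \<alpha>) - 1)"
        unfolding increment_kernel_def e q by simp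
      then show "(b * sinc (u * b) - a * sinc (u * a)) * exp (- t * \<bar>u\<bar> powr \<alpha>) =
          Re (?G (of_real u)) + (b * sinc (u * b) - a * sinc (u * a))"
        using \<open>u > 0\<close> assms by (simp add: field_simps)
    qed auto
    then show ?case by (simp add: integral_unique)
  qed
  ultimately show ?thesis by (rule Lim_transform_eventually)
qed

text \<open>
  The integrand is unchanged when \<open>(a, b)\<close> is replaced by \<open>(-b, -a)\<close>, so the negative half-line
  needs no separate contour.
\<close>

lemma stable_interval_measure:
  fixes a b :: real
  assumes "0 < \<alpha>" "\<alpha> \<le> 2" "0 < t" "0 < a" "a \<le> b"
    and "real_distribution \<mu>" "\<And>u. char \<mu> u = of_real (exp (- t * \<bar>u\<bar> powr \<alpha>))"
    and "\<And>x. measure \<mu> {x} = 0"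
  shows "pi * measure \<mu> {a<..b} = Re (ray_transform \<alpha> t 0 a - ray_transform \<alpha> t 0 b)"
    and "pi * measure \<mu> {-b<..-a} = Re (ray_transform \<alpha> t 0 a - ray_transform \<alpha> t 0 b)"
proof -
  let ?\<phi> = "\<lambda>u. exp (- t * \<bar>u\<bar> powr \<alpha>)"
  let ?I = "\<lambda>n. integral {0..real n} (\<lambda>u. (b * sinc (u * b) - a * sinc (u * a)) * ?\<phi> u)"
  have \<phi>: "continuous_on UNIV ?\<phi>"
    using assms by (intro continuous_intros continuous_on_powr') auto
  have lim: "?I \<longlonglongrightarrow> Re (ray_transform \<alpha> t 0 a - ray_transform \<alpha> t 0 b)"
    using assms by (intro filterlim_compose[OF stable_interval_integral_tendsto filterlim_real_sequentially]) auto
  have "?I \<longlonglongrightarrow> pi * measure \<mu> {a<..b}"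
    using assms \<phi> by (intro levy_inversion_real) auto
  then show "pi * measure \<mu> {a<..b} = Re (ray_transform \<alpha> t 0 a - ray_transform \<alpha> t 0 b)"
    by (rule LIMSEQ_unique[OF _ lim])
  have "(\<lambda>n. integral {0..real n} (\<lambda>u. (- a * sinc (u * - a) - - b * sinc (u * - b)) * ?\<phi> u))
      \<longlonglongrightarrow> pi * measure \<mu> {-b<..-a}"
    using assms \<phi> by (intro levy_inversion_real) auto
  then have "?I \<longlonglongrightarrow> pi * measure \<mu> {-b<..-a}" by (simp only: mult_minus_right mult_minus_left sinc_neg minus_diff_minus add.commute diff_conv_add_uminus minus_minus)
  then show "pi * measure \<mu> {-b<..-a} = Re (ray_transform \<alpha> t 0 a - ray_transform \<alpha> t 0 b)"
    by (rule LIMSEQ_unique[OF _ lim])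
qed

section \<open>From interval probabilities to the density and its derivatives\<close>

text \<open>\<open>deriv\<close> at a point depends only on nearby values, so on an open set the
  identity can be differentiated repeatedly. Openness allows the two half-lines to be treated
  separately.\<close>

lemma funpow_deriv_eq:
  fixes f :: "real \<Rightarrow> real" and h :: "nat \<Rightarrow> real \<Rightarrow> real"
  assumes "open S" "\<And>x. x \<in> S \<Longrightarrow> f x = h 0 x"
    and "\<And>k x. x \<in> S \<Longrightarrow> (h k has_real_derivative h (Suc k) x) (at x)"
    and "x \<in> S"
  shows "(deriv ^^ n) f x = h n x"
  using \<open>x \<in> S\<close>
proof (induction n arbitrary: x)
  case (Suc n)
  have "\<forall>\<^sub>F y in nhds x. (deriv ^^ n) f y = h n y"
    using eventually_nhds_in_open[OF assms(1) Suc.prems] by eventually_elim (rule Suc.IH)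
  then have "deriv ((deriv ^^ n) f) x = deriv (h n) x"
    by (rule deriv_cong_ev) simp
  also have "\<dots> = h (Suc n) x"
    by (rule DERIV_imp_deriv[OF assms(3)[OF Suc.prems]])
  finally show ?case by simp
qed (use assms in simp)

lemma measure_density_interval:
  fixes f :: "real \<Rightarrow> real"
  assumes "continuous_on UNIV f" "\<And>x. 0 \<le> f x" "a \<le> b"
  shows "measure (density lborel f) {a<..b} = integral {a..b} f"
proof -
  have f: "continuous_on {a..b} f" by (rule continuous_on_subset[OF assms(1)]) simp
  then have int: "set_integrable lborel {a..b} f"
    by (rule borel_integrable_atLeastAtMost')
  have [measurable]: "f \<in> borel_measurable borel"
    by (rule borel_measurable_continuous_onI[OF assms(1)])
  have "emeasure (density lborel f) {a<..b} = (\<integral>\<^sup>+x. ennreal (f x) * indicator {a<..b} x \<partial>lborel)"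
    by (subst emeasure_density) auto
  also have "\<dots> = (\<integral>\<^sup>+x. ennreal (indicator {a..b} x *\<^sub>R f x) \<partial>lborel)"
  proof (rule nn_integral_cong_AE)
    show "AE x in lborel. ennreal (f x) * indicator {a<..b} x = ennreal (indicator {a..b} x *\<^sub>R f x)"
      using AE_lborel_singleton[of a] by eventually_elim (auto simp: indicator_def)
  qed
  also have "\<dots> = ennreal (\<integral>x. indicator {a..b} x *\<^sub>R f x \<partial>lborel)"
    using int assms(2) unfolding set_integrable_def by (intro nn_integral_eq_integral) auto
  also have "(\<integral>x. indicator {a..b} x *\<^sub>R f x \<partial>lborel) = integral {a..b} f"
    using set_borel_integral_eq_integral(2)[OF int] by (simp add: set_lebesgue_integral_def)
  finally show ?thesis
    using assms f by (simp add: measure_def Henstock_Kurzweil_Integration.integral_nonneg integrable_continuous_real)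
qed

lemma eq_minus_deriv_of_integral_eq:
  fixes q h :: "real \<Rightarrow> real"
  assumes "continuous_on UNIV q" "\<And>a b. 0 < a \<Longrightarrow> a \<le> b \<Longrightarrow> integral {a..b} q = h a - h b"
    and "(h has_real_derivative h') (at x)" "0 < x"
  shows "q x = - h'"
proof -
  \<comment> \<open>The base point \<open>x / 2\<close> keeps the interval in the positive
    half-line, and \<open>x\<close> is interior to the interval ending at \<open>2 * x\<close>, so
    the one-sided derivative is two-sided.\<close>
  have "((\<lambda>y. integral {x/2..y} q) has_real_derivative q x) (at x within {x/2..2*x})"
    using assms by (intro integral_has_real_derivative continuous_on_subset[OF assms(1)]) auto
  then have "((\<lambda>y. integral {x/2..y} q) has_real_derivative q x) (at x)"
    using assms(4) by (subst (asm) at_within_interior) auto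
  moreover have "((\<lambda>y. h (x/2) - h y) has_real_derivative - h') (at x)"
    using assms(3) by (auto intro!: derivative_eq_intros)
  moreover have "\<forall>\<^sub>F y in nhds x. h (x/2) - h y = integral {x/2..y} q"
    using eventually_nhds_in_open[of "{x/2<..}" x] assms
    by (auto elim!: eventually_mono)
  ultimately show ?thesis
    by (metis DERIV_cong_ev DERIV_unique)
qed

text \<open>Interval probabilities are increments of \<open>Re (H 0) / pi\<close>, with the sign
  reversed. Differentiating in the right endpoint yields \<open>H 1\<close>, and continuity of
  \<open>f\<close> makes the identity hold at every point.\<close>

lemma stable_density_eq:
  fixes f :: "real \<Rightarrow> real" and \<alpha> t x :: real
  assumes "0 < \<alpha>" "\<alpha> \<le> 2" "0 < t" "0 < x"
    and "continuous_on UNIV f" "\<And>x. 0 \<le> f x" "prob_space (density lborel f)"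
    and "\<And>u. char (density lborel f) u = of_real (exp (- t * \<bar>u\<bar> powr \<alpha>))"
  shows "f x = - Re (ray_transform \<alpha> t 1 x) / pi" "f (- x) = - Re (ray_transform \<alpha> t 1 x) / pi"
proof -
  interpret laplace_weight "- (1 + \<i>)" "ray_weight \<alpha> t" "t * sqrt 2 powr \<alpha>" "\<alpha> - 1"
    using assms by (intro laplace_weight_ray) auto
  let ?\<mu> = "density lborel f"
  have rd: "real_distribution ?\<mu>"
    using assms(7) by (intro real_distribution.intro real_distribution_axioms.intro) auto
  have [measurable]: "f \<in> borel_measurable borel"
    by (rule borel_measurable_continuous_onI[OF assms(5)])
  \<comment> \<open>Levy's formula requires both endpoints to carry no mass.\<close>
  have atom: "measure ?\<mu> {y} = 0" for y
  proof -
    have "emeasure ?\<mu> {y} = (\<integral>\<^sup>+x. ennreal (f x) * indicator {y} x \<partial>lborel)"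
      by (subst emeasure_density) auto
    also have "\<dots> = (\<integral>\<^sup>+(x::real). 0 \<partial>lborel)"
    proof (rule nn_integral_cong_AE)
      show "AE x in lborel. ennreal (f x) * indicator {y} x = 0"
        using AE_lborel_singleton[of y] by eventually_elim simp
    qed
    finally show ?thesis by (simp add: measure_def)
  qed
  define h where "h y = Re (H 0 y) / pi" for y
  have h: "(h has_real_derivative Re (H 1 x) / pi) (at x)"
  proof -
    have "((\<lambda>y. Re (H 0 y)) has_real_derivative Re (H 1 x)) (at x)"
      using bounded_linear.has_vector_derivative[OF bounded_linear_Re has_vector_derivative_H[OF assms(4), of 0]]
      by (simp add: has_real_derivative_iff_has_vector_derivative)
    then show ?thesis unfolding h_def by (rule DERIV_cdivide)
  qed
  have m: "integral {a..b} f = h a - h b" "integral {-b..-a} f = h a - h b" if "0 < a" "a \<le> b" for a b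
    using stable_interval_measure[OF assms(1-3) that rd assms(8) atom]
      measure_density_interval[OF assms(5,6), of a b] measure_density_interval[OF assms(5,6), of "-b" "-a"] that
    by (simp_all add: h_def field_simps)
  show "f x = - Re (H 1 x) / pi"
    using eq_minus_deriv_of_integral_eq[OF assms(5) m(1) h assms(4)] by simp
  \<comment> \<open>The negative half-line follows by applying the same lemma to the reflected
    density.\<close>
  have "continuous_on UNIV (\<lambda>y. f (- y))"
    by (rule continuous_on_compose2[OF assms(5)]) (auto intro!: continuous_intros)
  from eq_minus_deriv_of_integral_eq[OF this _ h assms(4)] m(2)
  show "f (- x) = - Re (H 1 x) / pi"
    by (simp add: Henstock_Kurzweil_Integration.integral_reflect_real[of _ _ f, symmetric])
qed

text \<open>The density already involves \<open>H 1\<close>, so its \<open>n\<close>-th derivative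
  involves \<open>H (Suc n)\<close>. \<open>norm_H_le\<close> at \<epsilon> bounds it, and the
  factor \<open>t\<close> comes from the weight bound.\<close>

lemma stable_density_derivative_bound:
  fixes f :: "real \<Rightarrow> real" and \<alpha> t \<epsilon> x :: real
  assumes "0 < \<alpha>" "\<alpha> \<le> 2" "0 < t" "0 < \<epsilon>" "\<epsilon> < \<bar>x\<bar>"
    and "continuous_on UNIV f" "\<And>x. 0 \<le> f x" "prob_space (density lborel f)"
    and "\<And>u. char (density lborel f) u = of_real (exp (- t * \<bar>u\<bar> powr \<alpha>))"
  shows "\<bar>(deriv ^^ n) f x\<bar> \<le> norm (- (1 + \<i>)) ^ Suc n * sqrt 2 powr \<alpha> *
    (\<integral>s. indicator {0<..} s * (s powr (Suc n + (\<alpha> - 1)) * exp (- \<epsilon> * s)) \<partial>lborel) * t"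
proof -
  interpret laplace_weight "- (1 + \<i>)" "ray_weight \<alpha> t" "t * sqrt 2 powr \<alpha>" "\<alpha> - 1"
    using assms by (intro laplace_weight_ray) auto
  define h where "h k y = - Re (H (Suc k) y) / pi" for k y
  have h: "(h k has_real_derivative h (Suc k) y) (at y)" if "y > 0" for k y
  proof -
    have "((\<lambda>y. Re (H (Suc k) y)) has_real_derivative Re (H (Suc (Suc k)) y)) (at y)"
      using bounded_linear.has_vector_derivative[OF bounded_linear_Re has_vector_derivative_H[OF that]]
      by (simp add: has_real_derivative_iff_has_vector_derivative)
    then show ?thesis unfolding h_def by (intro DERIV_cdivide DERIV_minus)
  qed
  have f: "f y = h 0 y" "f (- y) = h 0 y" if "y > 0" for y
    using stable_density_eq[OF assms(1-3) that assms(6-9)] by (simp_all add: h_def)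
  have "\<bar>(deriv ^^ n) f x\<bar> = \<bar>h n \<bar>x\<bar>\<bar>"
  proof (cases "x > 0")
    case True
    have "(deriv ^^ n) f x = h n x"
      using True f h by (intro funpow_deriv_eq[of "{0<..}"]) auto
    then show ?thesis using True by simp
  next
    case False
    \<comment> \<open>Each derivative of the reflected function contributes a sign, which the
      absolute value discards.\<close>
    have "(deriv ^^ n) f x = (- 1) ^ n * h n (- x)"
    proof (rule funpow_deriv_eq[of "{..<0}"])
      fix k and y :: real assume "y \<in> {..<0}"
      then have "((\<lambda>y. h k (- y)) has_real_derivative h (Suc k) (- y) * - 1) (at y)"
        by (intro DERIV_chain2[OF h]) (auto intro!: derivative_eq_intros)
      from DERIV_cmult[OF this, of "(- 1) ^ k"]
      show "((\<lambda>y. (- 1) ^ k * h k (- y)) has_real_derivative (- 1) ^ Suc k * h (Suc k) (- y)) (at y)"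
        by (simp add: mult_ac)
    next
      fix y :: real assume "y \<in> {..<0}"
      then show "f y = (- 1) ^ 0 * h 0 (- y)" using f(2)[of "- y"] by simp
    qed (use False assms in auto)
    then show ?thesis using False by (simp add: abs_mult power_abs)
  qed
  \<comment> \<open>Dividing by \<open>pi > 1\<close> only helps, so it is weakened to division by
    1.\<close>
  also have "\<dots> \<le> norm (H (Suc n) \<bar>x\<bar>) / 1"
    unfolding h_def abs_divide abs_minus_cancel
    using pi_gt3 abs_Re_le_cmod by (intro frac_le) auto
  also have "\<dots> \<le> norm (- (1 + \<i>)) ^ Suc n * (t * sqrt 2 powr \<alpha>) *
    (\<integral>s. indicator {0<..} s * (s powr (Suc n + (\<alpha> - 1)) * exp (- \<epsilon> * s)) \<partial>lborel)"
    using assms norm_H_le[of \<epsilon> "\<bar>x\<bar>" "Suc n"] by simp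
  finally show ?thesis by (simp only: mult_ac)
qed

theorem corollary6p5:
  fixes \<alpha> :: real and M :: "'a measure" and X :: "real \<Rightarrow> 'a \<Rightarrow> real"
    and p :: "real \<Rightarrow> real \<Rightarrow> real"
  assumes "0 < \<alpha>" and "\<alpha> \<le> 2"
    and "symmetric_stable_levy_process \<alpha> M X"
    and "\<And>t. 0 < t \<Longrightarrow> smooth_density M (X t) (p t)"
  shows "\<forall>\<epsilon>>0. \<forall>n::nat. \<exists>c::real. \<forall>t. 0 < t \<and> t \<le> 1 \<longrightarrow>
           (SUP x\<in>{x::real. \<epsilon> < \<bar>x\<bar>}. ereal \<bar>(deriv ^^ n) (p t) x\<bar>) \<le> ereal (c * t)"
proof (intro allI impI exI SUP_least)
  fix \<epsilon> t x :: real and n :: nat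
  assume "0 < \<epsilon>" "0 < t \<and> t \<le> 1" "x \<in> {x. \<epsilon> < \<bar>x\<bar>}"
  then have t: "0 < t" and x: "\<epsilon> < \<bar>x\<bar>" by auto
  have pr: "prob_space M" and X: "X t \<in> borel_measurable M"
    and char: "\<And>u. char (distr M borel (X t)) u = of_real (exp (- t * \<bar>u\<bar> powr \<alpha>))"
    using assms(3) t by (auto simp: symmetric_stable_levy_process_def levy_process_def)
  have p: "\<And>x. 0 \<le> p t x" "distributed M lborel (X t) (\<lambda>x. ennreal (p t x))" "smooth (p t)"
    using assms(4)[OF t] by (auto simp: smooth_density_def)
  have "p t differentiable (at y)" for y
    using p(3)[unfolded smooth_def, rule_format, of 0 y] by simp
  then have cont: "continuous_on UNIV (p t)"
    by (intro continuous_at_imp_continuous_on ballI differentiable_imp_continuous_within)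
  have "distr M borel (X t) = distr M lborel (X t)"
    by (rule distr_cong) auto
  also have "\<dots> = density lborel (p t)"
    using p(2) by (simp add: distributed_def)
  finally have d: "distr M borel (X t) = density lborel (p t)" .
  \<comment> \<open>This fixes the witness for \<open>c\<close>, left open until here. It involves
    only \<alpha>, \<epsilon> and \<open>n\<close>, as is required of a constant chosen before
    \<open>t\<close> and \<open>x\<close>.\<close>
  show "ereal \<bar>(deriv ^^ n) (p t) x\<bar> \<le> ereal ((norm (- (1 + \<i>)) ^ Suc n * sqrt 2 powr \<alpha> *
    (\<integral>s. indicator {0<..} s * (s powr (Suc n + (\<alpha> - 1)) * exp (- \<epsilon> * s)) \<partial>lborel)) * t)"
    using stable_density_derivative_bound[OF assms(1,2) t \<open>0 < \<epsilon>\<close> x cont p(1)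
        prob_space.prob_space_distr[OF pr X, unfolded d] char[unfolded d], of n]
    by simp
qed

end
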